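(* Let $d_n^{\#1}$ be the number of rows with the value true in the truth tables of all the bracketed m-implications with $n$ variables, type 1, case 1. Then, as $n\to\infty$, $$d_n^{\#1} \sim \left(\frac{30-9\sqrt{10}}{10}\right)\frac{2^{3n-2}}{\sqrt{\pi n^3}}.$$
   Context: The m-implication of type 1 is the connective $\psi\rightharpoonup\phi\equiv\psi\to\neg\phi$, which has value 0 (false) exactly when $\psi$ and $\phi$ both have value 1 (true), and value 1 otherwise. A bracketed formula with $n$ distinct variables is obtained from $p_1\rightharpoonup p_2\rightharpoonup\cdots\rightharpoonup p_n$ (variables in this fixed order) by fully inserting brackets; for $n\ge2$ it has the form $\psi\rightharpoonup\phi$ with $\psi$ a bracketing of $p_1\rightharpoonup\cdots\rightharpoonup p_i$ and $\phi$ a bracketing of $p_{i+1}\rightharpoonup\cdots\rightharpoonup p_n$ for some $1\le i\le n-1$. A row is a pair consisting of a bracketed formula and a valuation of $p_1,\dots,p_n$ in $\{0,1\}$. Case 1 means: for $n\ge2$, $d_n^{\#1}$ counts the rows (over all bracketed formulae in $n$ variables) for which $\psi$ and $\phi$ both have value 0 (so that $\psi\rightharpoonup\phi$ is true). $u_n\sim v_n$ means $u_n/v_n\to1$. *)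

theory Defs
  imports Complex_Main "HOL-Library.FuncSet" "HOL-Library.Landau_Symbols"
begin

datatype mformula =
    Var nat
  | MImp mformula mformula  (infixr \<open>\<rightharpoonup>\<close> 55)

text \<open>The m-implication of type 1 abbreviates \<open>\<psi> \<longrightarrow> \<not> \<phi>\<close>.\<close>

primrec truth :: "(nat \<Rightarrow> bool) \<Rightarrow> mformula \<Rightarrow> bool" where
  "truth v (Var i) = v i"
| "truth v (\<psi> \<rightharpoonup> \<phi>) = (truth v \<psi> \<longrightarrow> \<not> truth v \<phi>)"

primrec var_word :: "mformula \<Rightarrow> nat list" where
  "var_word (Var i) = [i]"
| "var_word (\<psi> \<rightharpoonup> \<phi>) = var_word \<psi> @ var_word \<phi>"

text \<open>
  A formula tree records exactly the placement of the brackets, so the bracketings of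
  \<open>p\<^sub>1 \<rightharpoonup> \<dots> \<rightharpoonup> p\<^sub>n\<close> are the trees whose variables read from left to right are
  \<open>1, \<dots>, n\<close>.
\<close>

definition bracketings :: "nat \<Rightarrow> mformula set" where
  "bracketings n = {\<chi>. var_word \<chi> = [1..<Suc n]}"

text \<open>Valuations of \<open>p\<^sub>1, \<dots>, p\<^sub>n\<close> are extensional, so that there are \<open>2 ^ n\<close> of them.\<close>

definition rows :: "nat \<Rightarrow> (mformula \<times> (nat \<Rightarrow> bool)) set" where
  "rows n = bracketings n \<times> ({1..n} \<rightarrow>\<^sub>E UNIV)"

text \<open>For \<open>n < 2\<close> there are no rows in case 1, as no bracketing is an m-implication.\<close>

definition case1_rows :: "nat \<Rightarrow> (mformula \<times> (nat \<Rightarrow> bool)) set" where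
  "case1_rows n =
     {(\<chi>, v) \<in> rows n. \<exists>\<psi> \<phi>. \<chi> = (\<psi> \<rightharpoonup> \<phi>) \<and> \<not> truth v \<psi> \<and> \<not> truth v \<phi>}"

definition d_case1 :: "nat \<Rightarrow> nat" where
  "d_case1 n = card (case1_rows n)"

lemma case1_rows_true: "(\<chi>, v) \<in> case1_rows n \<Longrightarrow> truth v \<chi>"
  by (auto simp: case1_rows_def)

lemma var_word_nonempty: "var_word \<chi> \<noteq> []"
  by (induction \<chi>) auto

lemma MImp_in_bracketings_iff:
  "(\<psi> \<rightharpoonup> \<phi>) \<in> bracketings n \<longleftrightarrow>
     (\<exists>i. 1 \<le> i \<and> i < n \<and> var_word \<psi> = [1..<Suc i] \<and> var_word \<phi> = [Suc i..<Suc n])"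
proof
  assume "(\<psi> \<rightharpoonup> \<phi>) \<in> bracketings n"
  then have eq: "var_word \<psi> @ var_word \<phi> = [1..<Suc n]"
    by (simp add: bracketings_def)
  define i where "i = length (var_word \<psi>)"
  have "i + length (var_word \<phi>) = n"
    using arg_cong[OF eq, of length] by (simp add: i_def)
  moreover have "length (var_word \<phi>) > 0" "i > 0"
    using var_word_nonempty by (auto simp: i_def)
  ultimately have i: "1 \<le> i" "i < n"
    by auto
  have "var_word \<psi> = take i [1..<Suc n]" "var_word \<phi> = drop i [1..<Suc n]"
    unfolding eq[symmetric] by (simp_all add: i_def)
  with i show "\<exists>i. 1 \<le> i \<and> i < n \<and> var_word \<psi> = [1..<Suc i] \<and> var_word \<phi> = [Suc i..<Suc n]"
    by (intro exI[of _ i]) (simp add: take_upt drop_upt del: upt_Suc)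
next
  assume "\<exists>i. 1 \<le> i \<and> i < n \<and> var_word \<psi> = [1..<Suc i] \<and> var_word \<phi> = [Suc i..<Suc n]"
  then obtain i where i: "1 \<le> i" "i < n"
    "var_word \<psi> = [1..<Suc i]" "var_word \<phi> = [Suc i..<Suc n]"
    by blast
  have "[1..<Suc n] = [1..<Suc i] @ [Suc i..<Suc n]"
    using upt_add_eq_append[of 1 "Suc i" "n - i"] i(1,2) by (simp del: upt_Suc)
  with i show "(\<psi> \<rightharpoonup> \<phi>) \<in> bracketings n"
    by (simp add: bracketings_def del: upt_Suc)
qed

end

theory Submission
  imports Defs "HOL-Complex_Analysis.Complex_Analysis" "HOL-Real_Asymp.Real_Asymp"
begin

text \<open>
  Let \<open>F\<close> and \<open>G\<close> be the generating functions of the false rows and of all rows. Then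
  \<open>G = 2 x + G\<^sup>2\<close> and \<open>F = x + (G - F)\<^sup>2\<close>, and case 1 is counted by \<open>F\<^sup>2\<close>. Eliminating \<open>x\<close> gives
  \<open>F = f(G)\<close> with \<open>f(y) = (2 y + 1 - sqrt (1 + 2 y + 2 y\<^sup>2)) / 2\<close>, which is holomorphic for
  \<open>\<bar>y\<bar> < 1 / sqrt 2\<close>, whereas \<open>G\<close> takes only the value \<open>1 / 2\<close> at its singularity \<open>x = 1 / 8\<close>.
  The coefficients of the powers of \<open>G\<close> are ballot numbers: the \<open>n\<close>-th coefficient of \<open>G\<^sup>k\<close>
  divided by that of \<open>G\<close> is at most \<open>k / 2\<^sup>k\<^sup>-\<^sup>1\<close> and tends to it. By dominated convergence the
  coefficients of \<open>F\<^sup>2\<close> are asymptotic to those of \<open>G\<close> times the derivative of \<open>f\<^sup>2\<close> at \<open>1 / 2\<close>.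
\<close>

unbundle no vec_syntax and fps_syntax

section \<open>Counting rows\<close>

text \<open>The start \<open>a\<close> is free because the right part of a bracketing begins at a
  later variable.\<close>

definition segment_rows :: "nat \<Rightarrow> nat \<Rightarrow> bool \<Rightarrow> (mformula \<times> (nat \<Rightarrow> bool)) set" where
  "segment_rows a n b =
     {(\<chi>, v). var_word \<chi> = [a..<a + n] \<and> v \<in> {a..<a + n} \<rightarrow>\<^sub>E UNIV \<and> truth v \<chi> = b}"

text \<open>Fixing the values of both parts refines \<open>segment_rows\<close> for
  \<open>n > 1\<close>; case 1 is the instance \<open>a = 1\<close> with both values
  \<open>False\<close>.\<close>

definition split_rows :: "nat \<Rightarrow> nat \<Rightarrow> bool \<Rightarrow> bool \<Rightarrow> (mformula \<times> (nat \<Rightarrow> bool)) set" where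
  "split_rows a n b c =
     {(\<chi>, v). var_word \<chi> = [a..<a + n] \<and> v \<in> {a..<a + n} \<rightarrow>\<^sub>E UNIV \<and>
        (\<exists>\<psi> \<phi>. \<chi> = (\<psi> \<rightharpoonup> \<phi>) \<and> truth v \<psi> = b \<and> truth v \<phi> = c)}"

lemma truth_cong: "(\<And>x. x \<in> set (var_word \<chi>) \<Longrightarrow> v x = w x) \<Longrightarrow> truth v \<chi> = truth w \<chi>"
  by (induction \<chi>) auto

text \<open>A tree is a variable or splits its word into two shorter nonempty words, so finiteness
  follows by induction on the length.\<close>

lemma finite_var_word: "finite {\<chi>. var_word \<chi> = w}"
proof (induction "length w" arbitrary: w rule: less_induct)
  case less
  let ?P = "\<lambda>i. {\<psi>. var_word \<psi> = take i w} \<times> {\<phi>. var_word \<phi> = drop i w}"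
  have "{\<chi>. var_word \<chi> = w} \<subseteq>
      Var ` set w \<union> (\<Union>i\<in>{1..<length w}. (\<lambda>(\<psi>, \<phi>). \<psi> \<rightharpoonup> \<phi>) ` ?P i)"
  proof
    fix \<chi> assume *: "\<chi> \<in> {\<chi>. var_word \<chi> = w}"
    show "\<chi> \<in> Var ` set w \<union> (\<Union>i\<in>{1..<length w}. (\<lambda>(\<psi>, \<phi>). \<psi> \<rightharpoonup> \<phi>) ` ?P i)"
    proof (cases \<chi>)
      case (MImp \<psi> \<phi>)
      with * have w: "w = var_word \<psi> @ var_word \<phi>" by auto
      have "length (var_word \<psi>) \<in> {1..<length w}"
        using var_word_nonempty[of \<psi>] var_word_nonempty[of \<phi>] by (simp add: w Suc_le_eq)
      moreover have "\<chi> \<in> (\<lambda>(\<psi>, \<phi>). \<psi> \<rightharpoonup> \<phi>) ` ?P (length (var_word \<psi>))"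
        by (simp add: MImp w image_iff)
      ultimately show ?thesis by blast
    qed (use * in auto)
  qed
  moreover have "finite (?P i)" if "i \<in> {1..<length w}" for i
    using that by (intro finite_cartesian_product less) auto
  then have "finite (Var ` set w \<union> (\<Union>i\<in>{1..<length w}. (\<lambda>(\<psi>, \<phi>). \<psi> \<rightharpoonup> \<phi>) ` ?P i))"
    by blast
  ultimately show ?case
    by (rule finite_subset)
qed

lemma finite_segment_rows: "finite (segment_rows a n b)"
proof (rule finite_subset)
  show "segment_rows a n b \<subseteq> {\<chi>. var_word \<chi> = [a..<a + n]} \<times> ({a..<a + n} \<rightarrow>\<^sub>E UNIV)"
    by (auto simp: segment_rows_def)
  show "finite ({\<chi>. var_word \<chi> = [a..<a + n]} \<times> ({a..<a + n} \<rightarrow>\<^sub>E (UNIV :: bool set)))"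
    by (intro finite_cartesian_product finite_var_word finite_PiE) auto
qed

text \<open>The bound \<open>a + i + (n - i)\<close> gives the right part the shape demanded by
  \<open>segment_rows (a + i) (n - i)\<close>.\<close>

lemma append_eq_upt_iff:
  assumes "p \<noteq> []" "q \<noteq> []"
  shows "p @ q = [a..<a + n] \<longleftrightarrow>
    (\<exists>i\<in>{1..<n}. p = [a..<a + i] \<and> q = [a + i..<a + i + (n - i)])" (is "?L \<longleftrightarrow> ?R")
proof
  assume eq: ?L
  have "length p + length q = n"
    using arg_cong[OF eq, of length] by simp
  with assms have l: "length p \<in> {1..<n}"
    by (cases p; cases q) auto
  have "p = take (length p) [a..<a + n]" "q = drop (length p) [a..<a + n]"
    unfolding eq[symmetric] by simp_all
  with l show ?R by (intro bexI[of _ "length p"]) (simp_all add: take_upt drop_upt)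
next
  assume ?R
  then obtain i where i: "i \<in> {1..<n}" "p = [a..<a + i]" "q = [a + i..<a + i + (n - i)]"
    by blast
  have "[a..<a + n] = [a..<a + i] @ [a + i..<a + i + (n - i)]"
    using upt_add_eq_append[of a "a + i" "n - i"] i(1) by simp
  with i show ?L by simp
qed

section \<open>Bijection between split rows and pairs of rows of the two parts\<close>

definition merge :: "nat \<Rightarrow> (nat \<Rightarrow> 'a) \<Rightarrow> (nat \<Rightarrow> 'a) \<Rightarrow> nat \<Rightarrow> 'a" where
  "merge m v w = (\<lambda>x. if x < m then v x else w x)"

text \<open>Each valuation is \<open>undefined\<close> outside its own segment, so the single cut
  \<open>m\<close> suffices to glue the two and to recover both.\<close>

lemma merge_PiE:
  assumes "v \<in> {a..<m} \<rightarrow>\<^sub>E UNIV" "w \<in> {m..<b} \<rightarrow>\<^sub>E UNIV" "a \<le> m" "m \<le> b"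
  shows "merge m v w \<in> {a..<b} \<rightarrow>\<^sub>E UNIV"
    and "restrict (merge m v w) {a..<m} = v" "restrict (merge m v w) {m..<b} = w"
proof -
  have v: "v x = undefined" if "x \<notin> {a..<m}" for x
    using PiE_arb[OF assms(1) that] .
  have w: "w x = undefined" if "x \<notin> {m..<b}" for x
    using PiE_arb[OF assms(2) that] .
  show "merge m v w \<in> {a..<b} \<rightarrow>\<^sub>E UNIV"
    using assms(3,4) v w by (intro PiE_I) (auto simp: merge_def)
  show "restrict (merge m v w) {a..<m} = v" "restrict (merge m v w) {m..<b} = w"
    by (rule ext, simp add: merge_def v w restrict_def)+
qed

lemma merge_restrict:
  assumes "v \<in> {a..<b} \<rightarrow>\<^sub>E UNIV"
  shows "merge m (restrict v {a..<m}) (restrict v {m..<b}) = v"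
proof
  fix x
  have "v x = undefined" if "x \<notin> {a..<b}"
    using PiE_arb[OF assms that] .
  then show "merge m (restrict v {a..<m}) (restrict v {m..<b}) x = v x"
    by (cases "x \<in> {a..<b}") (auto simp: merge_def)
qed

lemma truth_merge:
  "var_word \<psi> = [a..<m] \<Longrightarrow> truth (merge m v w) \<psi> = truth v \<psi>"
  "var_word \<phi> = [m..<b] \<Longrightarrow> truth (merge m v w) \<phi> = truth w \<phi>"
  by (auto simp: merge_def intro!: truth_cong)

lemma truth_restrict: "var_word \<psi> = [a..<b] \<Longrightarrow> truth (restrict v {a..<b}) \<psi> = truth v \<psi>"
  by (auto intro!: truth_cong)

text \<open>The two parts share no variable, so their rows can be chosen independently. The cut is
  recovered as the word length of the left part.\<close>

lemma bij_betw_split_rows: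
  "bij_betw (\<lambda>(i, (\<psi>, v), (\<phi>, w)). (\<psi> \<rightharpoonup> \<phi>, merge (a + i) v w))
     (SIGMA i:{1..<n}. segment_rows a i b \<times> segment_rows (a + i) (n - i) c) (split_rows a n b c)"
  (is "bij_betw ?f ?A ?B")
proof (rule bij_betw_byWitness[where f' = "\<lambda>(\<chi>, v). case \<chi> of \<psi> \<rightharpoonup> \<phi> \<Rightarrow>
     (length (var_word \<psi>), (\<psi>, restrict v {a..<a + length (var_word \<psi>)}),
       (\<phi>, restrict v {a + length (var_word \<psi>)..<a + n}))"])
  let ?g = "\<lambda>(\<chi>, v). case \<chi> of \<psi> \<rightharpoonup> \<phi> \<Rightarrow>
     (length (var_word \<psi>), (\<psi>, restrict v {a..<a + length (var_word \<psi>)}),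
       (\<phi>, restrict v {a + length (var_word \<psi>)..<a + n}))"
  have AB: "?f x \<in> ?B \<and> ?g (?f x) = x" if "x \<in> ?A" for x
  proof -
    from that obtain i \<psi> v \<phi> w where x: "x = (i, (\<psi>, v), (\<phi>, w))" and i: "i \<in> {1..<n}"
      and v: "var_word \<psi> = [a..<a + i]" "v \<in> {a..<a + i} \<rightarrow>\<^sub>E UNIV" "truth v \<psi> = b"
      and w: "var_word \<phi> = [a + i..<a + i + (n - i)]" "w \<in> {a + i..<a + n} \<rightarrow>\<^sub>E UNIV"
        "truth w \<phi> = c"
      by (auto simp: segment_rows_def)
    have "var_word (\<psi> \<rightharpoonup> \<phi>) = [a..<a + n]"
      unfolding var_word.simps append_eq_upt_iff[OF var_word_nonempty var_word_nonempty]
      using i v(1) w(1) by blast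
    moreover have "?g (?f x) = x"
      using i merge_PiE(2,3)[OF v(2) w(2)] by (simp add: x v(1))
    ultimately show ?thesis
      using i v w merge_PiE(1)[OF v(2) w(2)] truth_merge[OF v(1)] truth_merge(2)[OF w(1)]
      by (simp add: x split_rows_def)
  qed
  have BA: "?g y \<in> ?A \<and> ?f (?g y) = y" if "y \<in> ?B" for y
  proof -
    from that obtain \<psi> \<phi> v where y: "y = (\<psi> \<rightharpoonup> \<phi>, v)" and v: "v \<in> {a..<a + n} \<rightarrow>\<^sub>E UNIV"
      and *: "var_word \<psi> @ var_word \<phi> = [a..<a + n]" "truth v \<psi> = b" "truth v \<phi> = c"
      by (auto simp: split_rows_def)
    from *(1) obtain i where i: "i \<in> {1..<n}"
      and w: "var_word \<psi> = [a..<a + i]" "var_word \<phi> = [a + i..<a + i + (n - i)]"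
      by (auto simp: append_eq_upt_iff var_word_nonempty)
    from w(2) i have w2: "var_word \<phi> = [a + i..<a + n]"
      by simp
    show ?thesis
      using i * w truth_restrict[OF w(1), of v] truth_restrict[OF w2, of v] merge_restrict[OF v, of "a + i"]
      by (simp add: y segment_rows_def)
  qed
  show "\<forall>x\<in>?A. ?g (?f x) = x" "?f ` ?A \<subseteq> ?B"
    using AB by blast+
  show "\<forall>y\<in>?B. ?f (?g y) = y" "?g ` ?B \<subseteq> ?A"
    using BA by blast+
qed

lemma card_split_rows_aux:
  "card (split_rows a n b c) =
     (\<Sum>i\<in>{1..<n}. card (segment_rows a i b) * card (segment_rows (a + i) (n - i) c))"
proof -
  have "card (split_rows a n b c) =
      card (SIGMA i:{1..<n}. segment_rows a i b \<times> segment_rows (a + i) (n - i) c)"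
    by (rule bij_betw_same_card[OF bij_betw_split_rows, symmetric])
  also have "\<dots> = (\<Sum>i\<in>{1..<n}. card (segment_rows a i b) * card (segment_rows (a + i) (n - i) c))"
    by (subst card_SigmaI) (auto simp: card_cartesian_product finite_segment_rows)
  finally show ?thesis .
qed

lemma segment_rows_unfold:
  assumes "n > 1"
  shows "segment_rows a n b = (\<Union>(c, d)\<in>{(c, d). (c \<longrightarrow> \<not> d) = b}. split_rows a n c d)"
proof (rule set_eqI, clarify)
  fix \<chi> v
  show "(\<chi>, v) \<in> segment_rows a n b \<longleftrightarrow>
      (\<chi>, v) \<in> (\<Union>(c, d)\<in>{(c, d). (c \<longrightarrow> \<not> d) = b}. split_rows a n c d)"
  proof (cases \<chi>)
    case (Var i)
    then have "var_word \<chi> \<noteq> [a..<a + n]"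
      using assms by (auto dest: arg_cong[of _ _ length])
    then show ?thesis
      by (simp add: segment_rows_def split_rows_def)
  next
    case (MImp \<psi> \<phi>)
    then show ?thesis
      by (auto simp: segment_rows_def split_rows_def)
  qed
qed

lemma card_segment_rows_rec:
  assumes "n > 1"
  shows "card (segment_rows a n b) =
    (\<Sum>(c, d)\<in>{(c, d). (c \<longrightarrow> \<not> d) = b}. card (split_rows a n c d))"
proof -
  have "finite (split_rows a n c d)" for c d
    using bij_betw_finite[OF bij_betw_split_rows, of n a c d] finite_segment_rows by auto
  then show ?thesis
    unfolding segment_rows_unfold[OF assms]
    by (subst card_UN_disjoint) (auto simp: split_rows_def case_prod_unfold)
qed

lemma segment_rows_0: "segment_rows a 0 b = {}"
  by (auto simp: segment_rows_def var_word_nonempty)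

lemma segment_rows_1: "segment_rows a 1 b = {(Var a, \<lambda>x. if x = a then b else undefined)}"
proof -
  have 1: "var_word \<chi> = [a] \<longleftrightarrow> \<chi> = Var a" for \<chi>
    by (cases \<chi>) (auto simp: var_word_nonempty append_eq_Cons_conv)
  have 2: "v = (\<lambda>x. if x = a then b else undefined)" if "v \<in> {a} \<rightarrow>\<^sub>E UNIV" "v a = b" for v
    using that PiE_arb[OF that(1)] by (intro ext) simp
  have 3: "{a..<a + 1} = {a}" "[a..<a + 1] = [a]"
    by auto
  show ?thesis
    unfolding segment_rows_def 1 3
  proof (intro set_eqI iffI)
    fix z assume "z \<in> {(\<chi>, v). \<chi> = Var a \<and> v \<in> {a} \<rightarrow>\<^sub>E UNIV \<and> truth v \<chi> = b}"
    then obtain v where "z = (Var a, v)" "v \<in> {a} \<rightarrow>\<^sub>E UNIV" "v a = b"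
      by auto
    with 2[of v] show "z \<in> {(Var a, \<lambda>x. if x = a then b else undefined)}"
      by blast
  next
    fix z assume "z \<in> {(Var a, \<lambda>x. if x = a then b else undefined)}"
    then show "z \<in> {(\<chi>, v). \<chi> = Var a \<and> v \<in> {a} \<rightarrow>\<^sub>E UNIV \<and> truth v \<chi> = b}"
      by (simp add: PiE_iff extensional_def)
  qed
qed

text \<open>Counts do not depend on the names of the variables. Induction through the recursion
  shows this without a renaming bijection.\<close>

lemma card_segment_rows_shift: "card (segment_rows a n b) = card (segment_rows 0 n b)"
proof (induction n arbitrary: a b rule: less_induct)
  case (less n)
  consider "n = 0" | "n = 1" | "n > 1" by linarith
  then show ?case
  proof cases
    case 3
    have "card (split_rows a n c d) = card (split_rows 0 n c d)" for c d
      unfolding card_split_rows_aux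
    proof (intro sum.cong refl)
      fix i assume "i \<in> {1..<n}"
      then have "i < n" "n - i < n" by auto
      then show "card (segment_rows a i c) * card (segment_rows (a + i) (n - i) d) =
          card (segment_rows 0 i c) * card (segment_rows (0 + i) (n - i) d)"
        using less[of i a c] less[of "n - i" "a + i" d] less[of "n - i" i d] by simp
    qed
    with 3 show ?thesis by (simp add: card_segment_rows_rec)
  qed (simp_all add: segment_rows_0 segment_rows_1[unfolded One_nat_def])
qed

lemma card_split_rows:
  "card (split_rows a n b c) =
     (\<Sum>i\<in>{1..<n}. card (segment_rows 0 i b) * card (segment_rows 0 (n - i) c))"
  unfolding card_split_rows_aux by (simp add: card_segment_rows_shift[of a] card_segment_rows_shift[of "a + _"])

lemma d_case1_eq: "d_case1 n = card (split_rows 1 n False False)"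
  unfolding d_case1_def case1_rows_def Defs.rows_def bracketings_def split_rows_def
  by (intro arg_cong[of _ _ card]) (auto simp: atLeastLessThanSuc_atLeastAtMost)

section \<open>Generating functions of the true and the false rows\<close>

definition row_fps :: "bool \<Rightarrow> complex fps" where
  "row_fps b = Abs_fps (\<lambda>n. of_nat (card (segment_rows 0 n b)))"

lemma row_fps_nth_0 [simp]: "row_fps b $ 0 = 0"
  by (simp add: row_fps_def segment_rows_0)

text \<open>The constant coefficients vanish, so the Cauchy product loses its end terms. By shift
  invariance \<open>a\<close> is arbitrary: \<open>0\<close> serves the functional equations,
  \<open>1\<close> serves case 1.\<close>

lemma row_fps_mult_nth: "(row_fps b * row_fps c) $ n = of_nat (card (split_rows a n b c))"
proof -
  have "(row_fps b * row_fps c) $ n = (\<Sum>i=0..n. row_fps b $ i * row_fps c $ (n - i))"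
    by (rule fps_mult_nth)
  also have "\<dots> = (\<Sum>i\<in>{1..<n}. row_fps b $ i * row_fps c $ (n - i))"
  proof (rule sum.mono_neutral_right)
    show "\<forall>i\<in>{0..n} - {1..<n}. row_fps b $ i * row_fps c $ (n - i) = 0"
    proof
      fix i assume "i \<in> {0..n} - {1..<n}"
      then have "i = 0 \<or> n - i = 0" by auto
      then show "row_fps b $ i * row_fps c $ (n - i) = 0" by auto
    qed
  qed auto
  finally show ?thesis by (simp add: row_fps_def card_split_rows)
qed

text \<open>A single variable contributes one row for each truth value, hence \<open>fps_X\<close>;
  every other row splits, and \<open>p\<close> runs over the values of the two parts that yield
  \<open>b\<close>.\<close>

lemma row_fps_eq: "row_fps b = fps_X + (\<Sum>p | (fst p \<longrightarrow> \<not> snd p) = b. row_fps (fst p) * row_fps (snd p))"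
proof (rule fps_ext)
  fix n :: nat
  let ?S = "{p. (fst p \<longrightarrow> \<not> snd p) = b}"
  have S: "(\<Sum>p\<in>?S. row_fps (fst p) * row_fps (snd p)) $ n
      = of_nat (\<Sum>p\<in>?S. card (split_rows 0 n (fst p) (snd p)))"
    unfolding fps_sum_nth row_fps_mult_nth[where a = 0] of_nat_sum ..
  have "card (segment_rows 0 n b)
      = (if n = 1 then 1 else 0) + (\<Sum>p\<in>?S. card (split_rows 0 n (fst p) (snd p)))"
  proof (cases "n > 1")
    case True
    then show ?thesis
      by (simp add: card_segment_rows_rec case_prod_unfold)
  next
    case False
    then have "n = 0 \<or> n = 1" by auto
    then show ?thesis
      by (auto simp: card_split_rows segment_rows_0 segment_rows_1[unfolded One_nat_def])
  qed
  then show "row_fps b $ n = (fps_X + (\<Sum>p\<in>?S. row_fps (fst p) * row_fps (snd p))) $ n"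
    unfolding fps_add_nth S by (simp add: row_fps_def)
qed

lemma row_fps_False: "row_fps False = fps_X + row_fps True ^ 2"
proof -
  have *: "{p. (fst p \<longrightarrow> \<not> snd p) = False} = {(True, True)}" by auto
  show ?thesis
    unfolding power2_eq_square by (rule trans[OF row_fps_eq]) (simp only: *, simp)
qed

lemma row_fps_True: "row_fps True = fps_X + row_fps False * (2 * row_fps True + row_fps False)"
proof -
  have *: "{p. (fst p \<longrightarrow> \<not> snd p) = True} = {(True, False), (False, True), (False, False)}" by auto
  show ?thesis
    by (rule trans[OF row_fps_eq]) (simp only: *, simp add: algebra_simps)
qed

lemma d_case1_conv_fps: "of_nat (d_case1 n) = (row_fps False ^ 2) $ n"
  by (simp add: power2_eq_square row_fps_mult_nth[where a = 1] d_case1_eq)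


section \<open>Powers of the generating function of all rows\<close>

text \<open>
  The equation for \<open>G\<close> gives \<open>G\<^sup>j\<^sup>+\<^sup>1 = 2 X G\<^sup>j + G\<^sup>j\<^sup>+\<^sup>2\<close>. In it the distance \<open>m\<close> of the index from the
  exponent drops for the last term, and the exponent drops for the other one.
\<close>

lemma ballot_power_nth_aux:
  fixes G :: "'a :: field_char_0 fps"
  assumes G: "G = 2 * fps_X + G ^ 2" and G0: "G $ 0 = 0"
  shows "G ^ Suc j $ (Suc j + m) =
    2 ^ (Suc j + m) * of_nat (Suc j) / of_nat (Suc j + m) * of_nat (j + 2 * m choose m)"
proof -
  have rec: "G ^ Suc j $ Suc n = 2 * G ^ j $ n + G ^ Suc (Suc j) $ Suc n" for j n
  proof -
    have "G ^ Suc j = G ^ j * G" by simp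
    also have "\<dots> = G ^ j * (2 * fps_X + G ^ 2)" using G by simp
    also have "\<dots> = 2 * (fps_X * G ^ j) + G ^ Suc (Suc j)"
      by (simp add: algebra_simps power2_eq_square)
    finally have "G ^ Suc j $ Suc n = (2 * (fps_X * G ^ j) + G ^ Suc (Suc j)) $ Suc n"
      by (rule arg_cong)
    then show ?thesis by (simp del: power_Suc)
  qed
  show ?thesis
  proof (induction m arbitrary: j)
    case 0
    have "G ^ j $ j = 2 ^ j" for j
    proof (induction j)
      case (Suc j)
      have "G ^ Suc (Suc j) $ Suc j = 0"
        using startsby_zero_power_prefix[OF G0, of "Suc (Suc j)"] by simp
      with Suc show ?case using rec[of j j] by simp
    qed simp
    from this[of "Suc j"] show ?case
      by (simp del: power_Suc of_nat_Suc)
  next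
    case (Suc m)
    note IHm = Suc
    show ?case
    proof (induction j)
      case 0
      \<comment> \<open>The other term of \<open>rec\<close> is a coefficient of
        \<open>G ^ 0 = 1\<close> at a positive index, hence zero.\<close>
      have "G ^ Suc 0 $ (Suc 0 + Suc m) = G ^ Suc (Suc 0) $ (Suc (Suc 0) + m)"
        using rec[of 0 "Suc m"] by simp
      also have "\<dots> = 2 ^ (m + 2) / of_nat (m + 2) * (of_nat 2 * of_nat (Suc (2 * m) choose m))"
        using IHm[of "Suc 0"] by (simp add: numeral_2_eq_2 del: of_nat_Suc power_Suc)
      also have "of_nat 2 * of_nat (Suc (2 * m) choose m) = (of_nat (Suc (Suc (2 * m)) choose Suc m) :: 'a)"
      proof -
        have "Suc (2 * m) choose Suc m = Suc (2 * m) choose m"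
          using binomial_symmetric[of m "Suc (2 * m)"] by simp
        then show ?thesis by simp
      qed
      finally show ?case by (simp del: binomial_Suc_Suc of_nat_Suc add: numeral_2_eq_2)
    next
      case (Suc j)
      \<comment> \<open>\<open>A\<close> and \<open>B\<close> are the binomials of the inner and the
        outer induction hypothesis. Absorption expresses \<open>A\<close> by \<open>B\<close>, which
        leaves a rational identity, and Pascal's rule gives \<open>A + B\<close>.\<close>
      define A :: 'a where "A = of_nat (j + 2 * m + 2 choose Suc m)"
      define B :: 'a where "B = of_nat (j + 2 * m + 2 choose m)"
      have "Suc m * (j + 2 * m + 2 choose Suc m) = (j + m + 2) * (j + 2 * m + 2 choose m)"
        using trans[OF binomial_absorption[of m "j + 2 * m + 2"] binomial_absorb_comp[symmetric]]
        by (simp del: binomial_Suc_Suc mult_Suc)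
      then have AB: "of_nat (Suc m) * A = of_nat (j + m + 2) * B"
        unfolding A_def B_def of_nat_mult[symmetric] by (simp only:)
      then have AB': "A = of_nat (j + m + 2) * B / of_nat (Suc m)"
        by (simp add: field_simps del: of_nat_Suc)
      have nz: "(of_nat m + 1 :: 'a) \<noteq> 0"
        "(of_nat j + of_nat m + 2 :: 'a) \<noteq> 0" "(of_nat j + of_nat m + 3 :: 'a) \<noteq> 0"
        using of_nat_neq_0[of m, where 'a='a] of_nat_neq_0[of "j + m + 1", where 'a='a]
          of_nat_neq_0[of "j + m + 2", where 'a='a]
        by (simp_all add: add_ac)
      have "G ^ Suc (Suc j) $ (Suc (Suc j) + Suc m) =
          2 * G ^ Suc j $ (Suc j + Suc m) + G ^ Suc (Suc (Suc j)) $ (Suc (Suc (Suc j)) + m)"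
        using rec[of "Suc j" "Suc j + Suc m"] by simp
      also have "\<dots> = 2 ^ (j + m + 3) * (of_nat (j + 1) / of_nat (j + m + 2) * A
          + of_nat (j + 3) / of_nat (j + m + 3) * B)"
        unfolding Suc IHm A_def B_def
        by (simp add: algebra_simps numeral_3_eq_3 del: of_nat_Suc binomial_Suc_Suc)
      also have "of_nat (j + 1) / of_nat (j + m + 2) * A + of_nat (j + 3) / of_nat (j + m + 3) * B
          = of_nat (j + 2) / of_nat (j + m + 3) * (A + B)"
        using nz unfolding AB' by (simp add: divide_simps) algebra
      also have "A + B = of_nat (Suc j + 2 * Suc m choose Suc m)"
        by (simp add: A_def B_def)
      finally show ?case
        by (simp add: numeral_3_eq_3 del: of_nat_Suc binomial_Suc_Suc)
    qed
  qed
qed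

text \<open>This form is uniform in \<open>k\<close>: binomial symmetry replaces the lower index by
  \<open>n\<close>, and for \<open>k > n\<close> both sides vanish.\<close>

lemma ballot_power_nth:
  fixes G :: "'a :: field_char_0 fps"
  assumes G: "G = 2 * fps_X + G ^ 2" and G0: "G $ 0 = 0" and n: "n > 0"
  shows "G ^ Suc k $ Suc n = 2 ^ Suc n / of_nat (Suc n) * of_nat (Suc k) * of_nat (2 * n - k choose n)"
proof (cases "k \<le> n")
  case True
  then obtain m where m: "n = k + m" by (auto simp: le_iff_add)
  have "k + 2 * m choose m = k + 2 * m choose (k + m)"
    using binomial_symmetric[of m "k + 2 * m"] by (simp add: add_ac)
  then show ?thesis
    using ballot_power_nth_aux[OF G G0, of k m] by (simp add: m del: of_nat_Suc power_Suc)
next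
  case False
  then show ?thesis
    using startsby_zero_power_prefix[OF G0, of "Suc k"] n by (simp add: binomial_eq_0 del: power_Suc)
qed

text \<open>For \<open>n > 0\<close>, \<open>Suc k\<close> times this is the quotient of the
  coefficients of \<open>G ^ Suc k\<close> and \<open>G\<close> at \<open>Suc n\<close>.\<close>

definition binomial_ratio :: "nat \<Rightarrow> nat \<Rightarrow> real" where
  "binomial_ratio n k = real (2 * n - k choose n) / real (2 * n choose n)"

text \<open>The factor lies between \<open>0\<close> and \<open>1 / 2\<close> and tends to
  \<open>1 / 2\<close>, which gives both the bound and the limit of the ratio by induction on
  \<open>k\<close>.\<close>

lemma binomial_ratio_Suc:
  assumes "n > 0" "k \<le> n"
  shows "binomial_ratio n (Suc k) = (real n - real k) / (2 * real n - real k) * binomial_ratio n k"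
proof -
  define N where "N = 2 * n - k"
  have N: "real N = 2 * real n - real k" "real (N - n) = real n - real k" "N > 0"
    using assms by (auto simp: N_def of_nat_diff)
  have "real (N - n) * real (N choose n) = real N * real (N - 1 choose n)"
    using binomial_absorb_comp[of N n] by (simp only: of_nat_mult[symmetric])
  then have "real (N - 1 choose n) = real (N - n) / real N * real (N choose n)"
    using N(3) by (simp add: field_simps)
  moreover have "N - 1 = 2 * n - Suc k" by (simp add: N_def)
  ultimately show ?thesis
    unfolding binomial_ratio_def N by (simp add: N_def[symmetric] N(1))
qed

lemma binomial_ratio_0: "binomial_ratio n 0 = 1"
  by (simp add: binomial_ratio_def)

lemma binomial_ratio_eq_0: "n > 0 \<Longrightarrow> k > n \<Longrightarrow> binomial_ratio n k = 0"
  by (simp add: binomial_ratio_def binomial_eq_0)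

lemma binomial_ratio_bounds:
  assumes "n > 0"
  shows "0 \<le> binomial_ratio n k \<and> binomial_ratio n k \<le> (1 / 2) ^ k"
proof (induction k)
  case (Suc k)
  show ?case
  proof (cases "k \<le> n")
    case True
    have "0 \<le> (real n - real k) / (2 * real n - real k)" "(real n - real k) / (2 * real n - real k) \<le> 1 / 2"
      using True assms by (auto simp: field_simps)
    then show ?thesis
      unfolding binomial_ratio_Suc[OF assms True] power_Suc
      using Suc by (intro conjI mult_mono mult_nonneg_nonneg) auto
  qed (simp add: binomial_ratio_eq_0 assms)
qed (simp add: binomial_ratio_0)

lemma binomial_ratio_tendsto: "(\<lambda>n. binomial_ratio n k) \<longlonglongrightarrow> (1 / 2) ^ k"
proof (induction k)
  case (Suc k)
  have "(\<lambda>n. (real n - real k) / (2 * real n - real k)) \<longlonglongrightarrow> 1 / 2"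
    by real_asymp
  from tendsto_mult[OF this Suc] have "(\<lambda>n. (real n - real k) / (2 * real n - real k) * binomial_ratio n k)
      \<longlonglongrightarrow> (1 / 2) ^ Suc k"
    by simp
  moreover have "eventually (\<lambda>n. (real n - real k) / (2 * real n - real k) * binomial_ratio n k =
      binomial_ratio n (Suc k)) sequentially"
    using eventually_gt_at_top[of k] by eventually_elim (simp add: binomial_ratio_Suc)
  ultimately show ?case
    by (rule Lim_transform_eventually)
qed (simp add: binomial_ratio_0)

text \<open>The scale is the coefficient of \<open>X\<^sup>n\<^sup>+\<^sup>1\<close> in \<open>G\<close>, that is, \<open>2\<^sup>n\<^sup>+\<^sup>1\<close> times a Catalan number.\<close>

definition ballot_scale :: "nat \<Rightarrow> real" where
  "ballot_scale n = 2 ^ Suc n / real (Suc n) * real (2 * n choose n)"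

text \<open>The factor \<open>Suc k\<close> in the coefficients of \<open>G ^ Suc k\<close> turns
  \<Phi> into its derivative. The sum is finite, as the ratios vanish for \<open>k > n\<close>; as a
  series it has a range independent of \<open>n\<close>.\<close>

lemma compose_nth_ballot:
  fixes G \<Phi> :: "complex fps"
  assumes G: "G = 2 * fps_X + G ^ 2" and G0: "G $ 0 = 0" and n: "n > 0"
  shows "(\<Phi> oo G) $ Suc n / of_real (ballot_scale n) = (\<Sum>k. fps_deriv \<Phi> $ k * of_real (binomial_ratio n k))"
proof -
  have nz: "ballot_scale n \<noteq> 0" "real (2 * n choose n) \<noteq> 0"
    by (simp_all add: ballot_scale_def)
  have *: "G ^ Suc k $ Suc n = of_real (ballot_scale n) * (of_nat (Suc k) * of_real (binomial_ratio n k))" for k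
  proof -
    have "ballot_scale n * (real (Suc k) * binomial_ratio n k) =
        2 ^ Suc n / real (Suc n) * real (Suc k) * real (2 * n - k choose n)"
      using nz(2) by (simp add: ballot_scale_def binomial_ratio_def field_simps del: of_nat_Suc power_Suc)
    then have "complex_of_real (ballot_scale n * (real (Suc k) * binomial_ratio n k)) =
        of_real (2 ^ Suc n / real (Suc n) * real (Suc k) * real (2 * n - k choose n))"
      by (rule arg_cong)
    then show ?thesis
      unfolding ballot_power_nth[OF G G0 n] by (simp del: power_Suc of_nat_Suc)
  qed
  have "(\<Phi> oo G) $ Suc n = (\<Sum>i=0..Suc n. \<Phi> $ i * (G ^ i $ Suc n))"
    by (rule fps_compose_nth)
  also have "\<dots> = (\<Sum>k=0..n. \<Phi> $ Suc k * (G ^ Suc k $ Suc n))"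
    by (subst sum.atLeast0_atMost_Suc_shift) simp
  also have "\<dots> = of_real (ballot_scale n) * (\<Sum>k=0..n. fps_deriv \<Phi> $ k * of_real (binomial_ratio n k))"
    unfolding * sum_distrib_left by (intro sum.cong refl) (simp add: mult_ac)
  also have "(\<Sum>k=0..n. fps_deriv \<Phi> $ k * of_real (binomial_ratio n k)) = (\<Sum>k. fps_deriv \<Phi> $ k * of_real (binomial_ratio n k))"
    by (rule suminf_finite[symmetric]) (use n in \<open>auto simp: binomial_ratio_eq_0\<close>)
  finally show ?thesis
    using nz by simp
qed

text \<open>Tannery's theorem allows the limit inside the series. The majorant is summable because
  \<open>1 / 2\<close> lies inside the disc of convergence of the derivative.\<close>

lemma compose_nth_asymptotics:
  fixes G \<Phi> :: "complex fps"
  assumes G: "G = 2 * fps_X + G ^ 2" and G0: "G $ 0 = 0" and conv: "fps_conv_radius \<Phi> > ereal (1 / 2)"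
  shows "(\<lambda>n. (\<Phi> oo G) $ Suc n / of_real (ballot_scale n)) \<longlonglongrightarrow> eval_fps (fps_deriv \<Phi>) (1 / 2)"
proof -
  let ?M = "\<lambda>k. norm (fps_deriv \<Phi> $ k * (1 / 2) ^ k)"
  have "ereal (norm (1 / 2 :: complex)) < fps_conv_radius \<Phi>"
    using conv by (simp add: norm_divide)
  also have "\<dots> \<le> fps_conv_radius (fps_deriv \<Phi>)"
    by (rule fps_conv_radius_deriv)
  finally have "summable ?M"
    by (rule norm_summable_fps)
  moreover have "norm (fps_deriv \<Phi> $ k * of_real (binomial_ratio n k)) \<le> ?M k" if "n > 0" for n k
    using binomial_ratio_bounds[OF that, of k] by (simp add: norm_mult norm_power norm_divide mult_left_mono)
  then have "eventually (\<lambda>(k, n). norm (fps_deriv \<Phi> $ k * of_real (binomial_ratio n k)) \<le> ?M k)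
      (at_top \<times>\<^sub>F sequentially)"
    unfolding eventually_prod_sequentially by (intro exI[of _ 1]) simp
  moreover have "(\<lambda>n. fps_deriv \<Phi> $ k * of_real (binomial_ratio n k))
      \<longlonglongrightarrow> fps_deriv \<Phi> $ k * (1 / 2) ^ k" for k
    using tendsto_of_real[OF binomial_ratio_tendsto[of k], where 'a = complex] by (intro tendsto_mult) auto
  ultimately have "(\<lambda>n. \<Sum>k. fps_deriv \<Phi> $ k * of_real (binomial_ratio n k))
      \<longlonglongrightarrow> (\<Sum>k. fps_deriv \<Phi> $ k * (1 / 2) ^ k)"
    using tannerys_theorem[of "\<lambda>k n. fps_deriv \<Phi> $ k * of_real (binomial_ratio n k)"
        "\<lambda>k. fps_deriv \<Phi> $ k * (1 / 2) ^ k" sequentially ?M] by auto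
  moreover have "eventually (\<lambda>n. (\<Sum>k. fps_deriv \<Phi> $ k * of_real (binomial_ratio n k)) =
      (\<Phi> oo G) $ Suc n / of_real (ballot_scale n)) sequentially"
    using eventually_gt_at_top[of 0] by eventually_elim (simp add: compose_nth_ballot[OF G G0])
  ultimately show ?thesis
    unfolding eval_fps_def by (rule Lim_transform_eventually)
qed

section \<open>Asymptotics of the scale\<close>

lemma central_binomial_asymptotics:
  "(\<lambda>n. real (2 * n choose n) * sqrt (real n) / 4 ^ n) \<longlonglongrightarrow> 1 / sqrt pi"
proof -
  \<comment> \<open>Up to the sign \<open>(-1)^n\<close>, \<open>-1/2 gchoose n\<close> equals
    \<open>(2 * n choose n) / 4 ^ n\<close>; the exponential is \<open>sqrt n\<close>, and the limit
    comes from \<open>Gamma (1/2) = sqrt pi\<close>.\<close>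
  let ?u = "\<lambda>n. ((-1/2 :: real) gchoose n) / ((-1)^n / exp ((-1/2+1) * of_real (ln (real n))))"
  have "?u \<longlonglongrightarrow> inverse (Gamma (- (-1/2)))"
    by (rule gbinomial_asymptotic)
  also have "inverse (Gamma (- (-1/2))) = 1 / sqrt pi"
    by (simp add: Gamma_one_half_real inverse_eq_divide)
  finally have lim: "?u \<longlonglongrightarrow> 1 / sqrt pi" .
  show ?thesis
  proof (rule Lim_transform_eventually[OF lim])
    show "eventually (\<lambda>n. ?u n = real (2 * n choose n) * sqrt (real n) / 4 ^ n) sequentially"
      using eventually_gt_at_top[of 0]
    proof eventually_elim
      case (elim n)
      have "real (2 * n choose n) = fact (2 * n) / (fact n * fact n)"
        using binomial_fact[of n "2 * n", where 'a = real] by (simp add: mult_2)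
      also have "\<dots> = 4 ^ n * pochhammer (1 / 2) n / fact n"
        unfolding fact_double by (simp add: power_mult)
      finally have 1: "real (2 * n choose n) = 4 ^ n * pochhammer (1 / 2) n / fact n" .
      have "exp ((-1/2+1) * of_real (ln (real n))) = sqrt (real n)"
        using elim by (simp add: powr_half_sqrt[symmetric] powr_def)
      then show ?case
        unfolding gbinomial_pochhammer 1 by (simp add: field_simps)
    qed
  qed
qed

text \<open>Since \<open>3 * Suc n - 2 = Suc n + 2 * n\<close>, the powers of two match exactly; the
  index shift only costs \<open>sqrt (Suc n) / sqrt n\<close>, which tends to
  \<open>1\<close>.\<close>

lemma ballot_scale_asymptotics:
  "(\<lambda>n. ballot_scale n / (2 ^ (3 * Suc n - 2) / sqrt (pi * real (Suc n) ^ 3))) \<longlonglongrightarrow> 1"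
proof -
  let ?u = "\<lambda>n. real (2 * n choose n) * sqrt (real n) / 4 ^ n *
    (sqrt pi * (sqrt (real (Suc n)) / sqrt (real n)))"
  have "(\<lambda>n. sqrt (real (Suc n)) / sqrt (real n)) \<longlonglongrightarrow> 1"
    by real_asymp
  then have "?u \<longlonglongrightarrow> 1 / sqrt pi * (sqrt pi * 1)"
    by (intro tendsto_mult central_binomial_asymptotics tendsto_const)
  then have lim: "?u \<longlonglongrightarrow> 1"
    by simp
  show ?thesis
  proof (rule Lim_transform_eventually[OF lim])
    show "eventually (\<lambda>n. ?u n =
        ballot_scale n / (2 ^ (3 * Suc n - 2) / sqrt (pi * real (Suc n) ^ 3))) sequentially"
      using eventually_gt_at_top[of 0]
    proof eventually_elim
      case (elim n)
      have "sqrt (pi * real (Suc n) ^ 3) = sqrt pi * (real (Suc n) * sqrt (real (Suc n)))"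
        by (simp add: real_sqrt_mult power3_eq_cube del: of_nat_Suc)
      moreover have "(2 :: real) ^ (3 * Suc n - 2) = 2 ^ Suc n * 4 ^ n"
      proof -
        have "3 * Suc n - 2 = Suc n + 2 * n" by simp
        then show ?thesis by (simp only: power_add power_mult) simp
      qed
      ultimately show ?case
        using elim by (simp add: ballot_scale_def del: of_nat_Suc power_Suc)
    qed
  qed
qed

section \<open>The false rows as a function of all rows\<close>

text \<open>Subtracting the equations gives a product equal to zero, whose second factor
  \<open>1 + 2 * G - F1 - F2\<close> has constant coefficient \<open>1\<close>.\<close>

lemma fps_quadratic_unique:
  fixes F1 F2 G H :: "'a :: idom fps"
  assumes "F1 = H + (G - F1) ^ 2" "F2 = H + (G - F2) ^ 2" "F1 $ 0 = 0" "F2 $ 0 = 0" "G $ 0 = 0"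
  shows "F1 = F2"
proof -
  have "(F1 - F2) * (1 + 2 * G - F1 - F2) = (F1 - (H + (G - F1) ^ 2)) - (F2 - (H + (G - F2) ^ 2))"
    by (simp add: algebra_simps power2_eq_square)
  also have "\<dots> = 0"
    using assms(1,2) by simp
  finally have "F1 - F2 = 0 \<or> 1 + 2 * G - F1 - F2 = 0"
    by simp
  moreover have "(1 + 2 * G - F1 - F2) $ 0 = 1"
    using assms(3-5) by simp
  ultimately show ?thesis
    by (metis eq_iff_diff_eq_0 fps_zero_nth zero_neq_one)
qed

text \<open>
  The root, vanishing at \<open>0\<close>, of the quadratic equation for \<open>F\<close> in which \<open>x\<close> has been
  replaced by \<open>(y - y\<^sup>2) / 2\<close> and \<open>G\<close> by \<open>y\<close>.
\<close>

definition false_root :: "complex \<Rightarrow> complex" where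
  "false_root y = (2 * y + 1 - csqrt (1 + 2 * y + 2 * y ^ 2)) / 2"

lemma false_root_eq: "false_root y = (y - y ^ 2) / 2 + (y - false_root y) ^ 2"
proof -
  have "csqrt (1 + 2 * y + 2 * y ^ 2) ^ 2 = 1 + 2 * y + 2 * y ^ 2" by simp
  then show ?thesis
    unfolding false_root_def by (simp add: field_simps power2_eq_square)
qed

text \<open>The radicand avoids the branch cut of \<open>csqrt\<close>. Its zeros
  \<open>(-1 + i) / 2\<close> and \<open>(-1 - i) / 2\<close> have modulus
  \<open>1 / sqrt 2\<close>; \<open>7 / 10\<close> is a rational radius between \<open>1 / 2\<close>
  and that modulus.\<close>

lemma radicand_notin_nonpos:
  fixes y :: complex
  assumes "norm y < 7 / 10"
  shows "1 + 2 * y + 2 * y ^ 2 \<notin> \<real>\<^sub>\<le>\<^sub>0"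
proof
  define a b where "a = Re y" and "b = Im y"
  assume "1 + 2 * y + 2 * y ^ 2 \<in> \<real>\<^sub>\<le>\<^sub>0"
  then have *: "1 + 2 * a + 2 * (a ^ 2 - b ^ 2) \<le> 0" "2 * b + 4 * a * b = 0"
    by (auto simp: complex_nonpos_Reals_iff a_def b_def power2_eq_square mult_ac)
  have "norm y ^ 2 < (7 / 10) ^ 2"
    using assms by (intro power_strict_mono) auto
  then have ab: "a ^ 2 + b ^ 2 < 49 / 100"
    by (simp add: cmod_power2 a_def b_def power_divide)
  have "b * (1 + 2 * a) = 0"
    using *(2) by (simp add: algebra_simps)
  then consider "b = 0" | "a = -1/2"
    by fastforce
  then show False
  proof cases
    case 1
    have "0 < (a + 1) ^ 2 + a ^ 2"
      by (cases "a = 0") (auto intro!: add_nonneg_pos)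
    with 1 * show False by (simp add: power2_eq_square algebra_simps)
  next
    case 2
    \<comment> \<open>Here the radicand is \<open>1 / 2 - 2 * b ^ 2\<close>, while \<open>ab\<close>
      forces \<open>b ^ 2 < 24 / 100\<close>.\<close>
    with *(1) ab show False by (simp add: power2_eq_square)
  qed
qed

lemma has_field_derivative_false_root:
  assumes "norm y < 7 / 10"
  shows "(false_root has_field_derivative (1 - (1 + 2 * y) / (2 * csqrt (1 + 2 * y + 2 * y ^ 2)))) (at y)"
  unfolding false_root_def[abs_def] using radicand_notin_nonpos[OF assms]
  by (auto intro!: derivative_eq_intros simp: field_simps)

lemma holomorphic_false_root: "false_root holomorphic_on ball 0 (7 / 10)"
  using has_field_derivative_false_root
  by (subst holomorphic_on_open) (simp, force)

definition false_fps :: "complex fps" where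
  "false_fps = fps_expansion false_root 0"

lemma has_fps_expansion_false_root [fps_expansion_intros]: "false_root has_fps_expansion false_fps"
  unfolding false_fps_def using holomorphic_false_root by (intro has_fps_expansion_fps_expansion) auto

text \<open>Uniqueness of power series expansions carries \<open>false_root_eq\<close> over to
  formal series.\<close>

lemma false_fps_eq: "false_fps = fps_const (1 / 2) * (fps_X - fps_X ^ 2) + (fps_X - false_fps) ^ 2"
proof (rule fps_expansion_unique_complex)
  show "false_root has_fps_expansion false_fps"
    by (rule has_fps_expansion_false_root)
  have "(\<lambda>y. 1 / 2 * (y - y ^ 2) + (y - false_root y) ^ 2) has_fps_expansion
      fps_const (1 / 2) * (fps_X - fps_X ^ 2) + (fps_X - false_fps) ^ 2"
    unfolding power2_eq_square by (intro fps_expansion_intros)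
  also have "(\<lambda>y. 1 / 2 * (y - y ^ 2) + (y - false_root y) ^ 2) = false_root"
    using false_root_eq by (simp add: fun_eq_iff)
  finally show "false_root has_fps_expansion fps_const (1 / 2) * (fps_X - fps_X ^ 2) + (fps_X - false_fps) ^ 2" .
qed

lemma false_fps_nth_0: "false_fps $ 0 = 0"
  by (simp add: false_fps_def fps_expansion_def false_root_def)

text \<open>Substituting \<open>G\<close> turns \<open>(X - X^2) / 2\<close> into \<open>X\<close>,
  because \<open>G - G ^ 2 = 2 * fps_X\<close>. The composition thus solves the quadratic equation
  of \<open>F\<close>, whose solution is unique.\<close>

lemma eq_false_fps_compose:
  fixes F G :: "complex fps"
  assumes F: "F = fps_X + (G - F) ^ 2" and G: "G = 2 * fps_X + G ^ 2" and "F $ 0 = 0" "G $ 0 = 0"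
  shows "F = false_fps oo G"
proof (rule fps_quadratic_unique)
  have "false_fps oo G = (fps_const (1 / 2) * (fps_X - fps_X ^ 2) + (fps_X - false_fps) ^ 2) oo G"
    using false_fps_eq by simp
  also have "\<dots> = fps_const (1 / 2) * (G - G ^ 2) + (G - (false_fps oo G)) ^ 2"
    using assms(4)
    by (simp add: fps_compose_add_distrib fps_compose_sub_distrib fps_compose_mult_distrib power2_eq_square)
  also have "G - G ^ 2 = 2 * fps_X"
    using G by (metis add_diff_cancel_right')
  also have "fps_const (1 / 2) * (2 * fps_X) = (fps_X :: complex fps)"
    by (simp add: numeral_fps_const mult.assoc[symmetric])
  finally show "false_fps oo G = fps_X + (G - (false_fps oo G)) ^ 2" .
  show "(false_fps oo G) $ 0 = 0"
    by (simp add: false_fps_nth_0)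
qed (use assms in auto)

text \<open>Holomorphy on the disc of radius \<open>7 / 10\<close> bounds the radius of convergence
  from below and identifies the value with \<open>2 * f(1/2) * f'(1/2)\<close> for
  \<open>f = false_root\<close>.\<close>

lemma false_fps_square:
  shows "fps_conv_radius (false_fps ^ 2) > ereal (1 / 2)"
    and "eval_fps (fps_deriv (false_fps ^ 2)) (1 / 2) = of_real ((30 - 9 * sqrt 10) / 10)"
proof -
  let ?f = "\<lambda>y. false_root y ^ 2"
  have ex: "?f has_fps_expansion false_fps ^ 2"
    unfolding power2_eq_square by (intro fps_expansion_intros)
  have holo: "?f holomorphic_on ball 0 (7 / 10)"
    by (intro holomorphic_intros holomorphic_false_root)
  have "ereal (1 / 2) < ereal (7 / 10)"
    by simp
  also have "\<dots> \<le> fps_conv_radius (false_fps ^ 2)"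
    by (rule holomorphic_on_imp_fps_conv_radius_ge[OF ex]) (use holo in simp)
  finally show rad: "fps_conv_radius (false_fps ^ 2) > ereal (1 / 2)" .

  \<comment> \<open>The radicand at \<open>1 / 2\<close> is \<open>5 / 2\<close>, with root
    \<open>s\<close>; hence \<open>f(1/2) = 1 - s / 2\<close> and
    \<open>f'(1/2) = 1 - 1 / s\<close>.\<close>
  define s where "s = sqrt 10 / 2"
  have s2: "s * s = 5 / 2" and s0: "s > 0"
    by (simp_all add: s_def)
  have arg: "1 + 2 * (1 / 2) + 2 * (1 / 2) ^ 2 = complex_of_real (5 / 2)"
    by (simp add: power2_eq_square)
  have "csqrt (complex_of_real (5 / 2)) = of_real (sqrt (5 / 2))"
    by (rule of_real_sqrt[symmetric]) simp
  also have "sqrt (5 / 2) = s"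
    by (rule real_sqrt_unique) (use s2 s0 in \<open>auto simp: power2_eq_square\<close>)
  finally have s: "csqrt (1 + 2 * (1 / 2) + 2 * (1 / 2) ^ 2) = of_real s"
    unfolding arg .
  have "eval_fps (fps_deriv (false_fps ^ 2)) (1 / 2) = deriv (eval_fps (false_fps ^ 2)) (1 / 2)"
    using rad by (intro eval_fps_deriv) (simp add: norm_divide)
  also have "\<dots> = deriv ?f (1 / 2)"
  proof (rule deriv_cong_ev)
    have "eventually (\<lambda>y. y \<in> ball 0 (7 / 10)) (nhds (1 / 2 :: complex))"
      by (intro eventually_nhds_in_open) (auto simp: norm_divide)
    then show "eventually (\<lambda>y. eval_fps (false_fps ^ 2) y = ?f y) (nhds (1 / 2))"
      by eventually_elim (rule has_fps_expansion_imp_eval_fps_eq[OF ex _ holo], simp)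
  qed simp
  also have "\<dots> = 2 * false_root (1 / 2) * (1 - (1 + 2 * (1 / 2)) / (2 * csqrt (1 + 2 * (1 / 2) + 2 * (1 / 2) ^ 2)))"
    by (rule DERIV_imp_deriv)
      (auto intro!: derivative_eq_intros has_field_derivative_false_root simp: norm_divide)
  also have "\<dots> = of_real (2 * (1 - s / 2) * (1 - 1 / s))"
    unfolding false_root_def s by (simp add: field_simps)
  also have "2 * (1 - s / 2) * (1 - 1 / s) = (30 - 9 * sqrt 10) / 10"
  proof -
    have inv: "1 / s = 2 / 5 * s"
      using s2 s0 by (simp add: field_simps)
    have "2 * (1 - s / 2) * (1 - 1 / s) = 2 - 9 / 5 * s + 2 / 5 * (s * s)"
      unfolding inv by (simp add: field_simps)
    then show ?thesis
      unfolding s2 by (simp add: s_def)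
  qed
  finally show "eval_fps (fps_deriv (false_fps ^ 2)) (1 / 2) = of_real ((30 - 9 * sqrt 10) / 10)" .
qed

theorem theorem7p5:
  shows "(\<lambda>n. real (d_case1 n)) \<sim>[at_top]
    (\<lambda>n. ((30 - 9 * sqrt 10) / 10) * (2 ^ (3 * n - 2) / sqrt (pi * real n ^ 3)))"
proof -
  define F G where "F = row_fps False" and "G = row_fps True + row_fps False"
  define c where "c = (30 - 9 * sqrt 10) / 10"
  let ?h = "\<lambda>n. 2 ^ (3 * n - 2) / sqrt (pi * real n ^ 3)"
  have G: "G = 2 * fps_X + G ^ 2"
  proof -
    have "G = (fps_X + row_fps False * (2 * row_fps True + row_fps False)) +
        (fps_X + row_fps True ^ 2)"
      unfolding G_def row_fps_True[symmetric] row_fps_False[symmetric] ..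
    also have "\<dots> = 2 * fps_X + G ^ 2"
      by (simp add: G_def algebra_simps power2_eq_square)
    finally show ?thesis .
  qed
  have "F = fps_X + (G - F) ^ 2"
    using row_fps_False by (simp add: F_def G_def)
  then have "F = false_fps oo G"
    by (rule eq_false_fps_compose[OF _ G]) (simp_all add: F_def G_def)
  then have d: "of_nat (d_case1 n) = ((false_fps ^ 2) oo G) $ n" for n
    unfolding d_case1_conv_fps F_def[symmetric] by (simp add: G_def fps_compose_power)
  \<comment> \<open>The index is \<open>Suc n\<close> because \<open>ballot_scale n\<close> belongs
    to the coefficient at \<open>Suc n\<close>; \<open>LIMSEQ_imp_Suc\<close> removes the shift
    below.\<close>
  have "(\<lambda>n. of_nat (d_case1 (Suc n)) / of_real (ballot_scale n)) \<longlonglongrightarrow> complex_of_real c"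
    unfolding d c_def false_fps_square(2)[symmetric]
    by (rule compose_nth_asymptotics[OF G _ false_fps_square(1)]) (simp add: G_def)
  then have "(\<lambda>n. complex_of_real (real (d_case1 (Suc n)) / ballot_scale n)) \<longlonglongrightarrow> complex_of_real c"
    by simp
  then have "(\<lambda>n. real (d_case1 (Suc n)) / ballot_scale n) \<longlonglongrightarrow> c"
    unfolding tendsto_of_real_iff .
  from tendsto_mult[OF this ballot_scale_asymptotics]
  have "(\<lambda>n. real (d_case1 (Suc n)) / ?h (Suc n)) \<longlonglongrightarrow> c"
    by (simp add: ballot_scale_def)
  then have "(\<lambda>n. real (d_case1 n) / ?h n) \<longlonglongrightarrow> c"
    by (rule LIMSEQ_imp_Suc)
  \<comment> \<open>Division by \<open>c\<close> normalises the limit to \<open>1\<close>. If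
    \<open>c\<close> were zero, squaring \<open>sqrt 10 = 10 / 3\<close> would give
    \<open>100 / 9 = 10\<close>.\<close>
  moreover have "c \<noteq> 0"
  proof
    assume "c = 0"
    then have "sqrt 10 = 10 / 3"
      by (simp add: c_def)
    then have "(10 / 3) ^ 2 = (10 :: real)"
      by (metis abs_numeral real_sqrt_abs real_sqrt_power)
    then show False
      by (simp add: power2_eq_square)
  qed
  ultimately have "(\<lambda>n. 1 / c * (real (d_case1 n) / ?h n)) \<longlonglongrightarrow> 1 / c * c"
    by (intro tendsto_mult tendsto_const)
  with \<open>c \<noteq> 0\<close> have "(\<lambda>n. real (d_case1 n) / (c * ?h n)) \<longlonglongrightarrow> 1"
    by simp
  then show ?thesis
    unfolding c_def by (rule asymp_equivI')
qed

end
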